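(* Let $A\in\mathbb{R}^{n\times n}$, $B\in\mathbb{R}^{n\times m}$, and let $U_{0,1,T},X_{0,T},X_{1,T}$ be the data matrices of a noiseless trajectory of $x(t+1)=Ax(t)+Bu(t)$. Assume $$\operatorname{rank}\begin{bmatrix}U_{0,1,T}\\ X_{0,T}\end{bmatrix}=n+m ,$$ and let $H_d,F_d,G_d,W_d,S_d$ be the data-based matrices defined in the context. Assume that, for every $x$ for which the data-driven program $$\min_{z\in\mathbb{R}^{mN_u}} z'H_dz\quad\text{s.t.}\quad G_dz\le W_d+S_dx$$ is feasible, the rows of $G_d$ corresponding to the constraints active at its optimum are linearly independent. Then the data-driven explicit predictive law is equivalent to the model-based explicit predictive controller: the two laws are defined for the same states $x$ and prescribe the same control action $u(x)\in\mathbb{R}^m$ for each such $x$.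
   Context: **Notation.** $'$ denotes transpose, vector inequalities are componentwise, and $D^\dagger$ denotes a right inverse of a full-row-rank matrix $D$. **Data.** $U_{0,1,T}=[u(0)\ \cdots\ u(T-1)]$, $X_{0,T}=[x(0)\ \cdots\ x(T-1)]$, $X_{1,T}=[x(1)\ \cdots\ x(T)]$. **Design parameters.** Horizons $N_x,N_u,N_c\ge1$ with $N_u\le N_x$, symmetric $Q\succeq0$, $P\succeq0$, $R\succ0$, a gain $K\in\mathbb{R}^{m\times n}$, and constraint data $\mathcal{C}_x,\mathcal{C}_u,d$ of compatible sizes. **QP matrices associated with a pair $(\bar A,\bar B)$.** For $U=(u(0)',\dots,u(N_u-1)')'\in\mathbb{R}^{mN_u}$ consider the predictions $\bar x(0)=x$, $\bar x(k+1)=\bar A\bar x(k)+\bar Bu(k)$, where $u(k)$ is the $k$-th block of $U$ for $k<N_u$ and $u(k)=K\bar x(k)$ for $k\ge N_u$. Write $\bar x(k)=\Phi_kx+\Psi_kU$ and $u(k)=\Theta_kx+\Lambda_kU$. Define - $H=\Psi_{N_x}'P\Psi_{N_x}+\sum_{k=0}^{N_x-1}(\Psi_k'Q\Psi_k+\Lambda_k'R\Lambda_k)$, which is positive definite since $R\succ0$; - $F=\Phi_{N_x}'P\Psi_{N_x}+\sum_{k=0}^{N_x-1}(\Phi_k'Q\Psi_k+\Theta_k'R\Lambda_k)$; - $G$, $W$, $E$: the vertical stacking over $k=0,\dots,N_c-1$ of the blocks $\mathcal{C}_x\Psi_k+\mathcal{C}_u\Lambda_k$, of $d$, and of $-(\mathcal{C}_x\Phi_k+\mathcal{C}_u\Theta_k)$,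 respectively; - $S=E+GH^{-1}F'$. **Model-based explicit controller.** Take $(\bar A,\bar B)=(A,B)$. The controller is the map sending each $x$ for which $\min_z z'Hz$ s.t. $Gz\le W+Sx$ is feasible to the first $m$ components $u(x)$ of $U(x)=z(x)-H^{-1}F'x$, where $z(x)$ is the unique minimizer. This $U(x)$ is the solution of the constrained optimal control problem of minimizing $x(N_x)'Px(N_x)+\sum_{k=0}^{N_x-1}[x(k)'Qx(k)+u(k)'Ru(k)]$ over $U$, subject to $x(0)=x$, $x(k+1)=Ax(k)+Bu(k)$, $\mathcal{C}_xx(k)+\mathcal{C}_uu(k)\le d$ for $0\le k\le N_c-1$, and $u(k)=Kx(k)$ for $k\ge N_u$. In explicit form it is a piecewise affine law $u(x)=F_ix+g_i$ if $\mathcal{H}_ix\le\mathcal{K}_i$. **Data-driven explicit law.** Take $(\bar A,\bar B)=(\xi_d,\gamma_d)$, where $$[\gamma_d\ \ \xi_d]=X_{1,T}\begin{bmatrix}U_{0,1,T}\\ X_{0,T}\end{bmatrix}^\dagger .$$ The resulting matrices are denoted $H_d,F_d,G_d,W_d,S_d$, and the law is obtained by the same construction: it sends $x$ to the first $m$ components of $z_d(x)-H_d^{-1}F_d'x$, with $z_d(x)$ the unique minimizer of the data-driven program. *)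

theory Defs
  imports
    "Jordan_Normal_Form.DL_Rank"
    "Jordan_Normal_Form.Gauss_Jordan_Elimination"
begin

definition hcat :: "real mat \<Rightarrow> real mat \<Rightarrow> real mat" where
  "hcat M N = (M\<^sup>T @\<^sub>r N\<^sup>T)\<^sup>T"

definition vstack :: "nat \<Rightarrow> real mat list \<Rightarrow> real mat" where
  "vstack nc Ms = foldr (@\<^sub>r) Ms (0\<^sub>m 0 nc)"

definition vstack_vec :: "real vec list \<Rightarrow> real vec" where
  "vstack_vec vs = foldr (@\<^sub>v) vs (vec 0 (\<lambda>_. 0))"

definition mat_sum :: "nat \<Rightarrow> nat \<Rightarrow> (nat \<Rightarrow> real mat) \<Rightarrow> nat set \<Rightarrow> real mat" where
  "mat_sum nr nc f I = finsum (module_mat TYPE(real) nr nc) f I"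

definition pos_semidef :: "nat \<Rightarrow> real mat \<Rightarrow> bool" where
  "pos_semidef n M \<longleftrightarrow> M \<in> carrier_mat n n \<and> M\<^sup>T = M \<and>
     (\<forall>v \<in> carrier_vec n. 0 \<le> v \<bullet> (M *\<^sub>v v))"

definition pos_def :: "nat \<Rightarrow> real mat \<Rightarrow> bool" where
  "pos_def n M \<longleftrightarrow> M \<in> carrier_mat n n \<and> M\<^sup>T = M \<and>
     (\<forall>v \<in> carrier_vec n. v \<noteq> 0\<^sub>v n \<longrightarrow> 0 < v \<bullet> (M *\<^sub>v v))"

definition is_right_inverse :: "real mat \<Rightarrow> real mat \<Rightarrow> bool" where
  "is_right_inverse M R \<longleftrightarrow>
     R \<in> carrier_mat (dim_col M) (dim_row M) \<and> M * R = 1\<^sub>m (dim_row M)"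

(* Independence of the family of rows indexed by I: since lin_dep speaks about sets, two equal
   rows with different indices must be excluded separately. *)
definition rows_lin_indep :: "real mat \<Rightarrow> nat set \<Rightarrow> bool" where
  "rows_lin_indep M I \<longleftrightarrow> inj_on (row M) I \<and>
     \<not> module.lin_dep class_ring (module_vec TYPE(real) (dim_col M)) (row M ` I)"

(* Horizons N_x, N_u, N_c; weights Q, P, R; terminal gain K;
   mixed constraints C_x x + C_u u \<le> d. *)
record mpc_design =
  Nx :: nat
  Nu :: nat
  Nc :: nat
  wtQ :: "real mat"
  wtP :: "real mat"
  wtR :: "real mat"
  gainK :: "real mat"
  conX :: "real mat"
  conU :: "real mat"
  conD :: "real vec"

definition input_block :: "nat \<Rightarrow> real vec \<Rightarrow> nat \<Rightarrow> real vec" where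
  "input_block m U k = vec m (\<lambda>i. U $ (k * m + i))"

context
  fixes D :: mpc_design and A B :: "real mat"
begin

fun pred_state :: "real vec \<Rightarrow> real vec \<Rightarrow> nat \<Rightarrow> real vec"
  and pred_input :: "real vec \<Rightarrow> real vec \<Rightarrow> nat \<Rightarrow> real vec" where
  "pred_state x U 0 = x"
| "pred_state x U (Suc k) = A *\<^sub>v pred_state x U k + B *\<^sub>v pred_input x U k"
| "pred_input x U k =
     (if k < Nu D then input_block (dim_col B) U k else gainK D *\<^sub>v pred_state x U k)"

(* The coefficient matrices of the predictions:
   xbar(k) = Phi k x + Psi k U and u(k) = Theta k x + Lam k U, see prediction below. *)
fun Phi :: "nat \<Rightarrow> real mat" and Theta :: "nat \<Rightarrow> real mat" where
  "Phi 0 = 1\<^sub>m (dim_row A)"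
| "Phi (Suc k) = A * Phi k + B * Theta k"
| "Theta k = (if k < Nu D then 0\<^sub>m (dim_col B) (dim_row A) else gainK D * Phi k)"

fun Psi :: "nat \<Rightarrow> real mat" and Lam :: "nat \<Rightarrow> real mat" where
  "Psi 0 = 0\<^sub>m (dim_row A) (dim_col B * Nu D)"
| "Psi (Suc k) = A * Psi k + B * Lam k"
| "Lam k = (if k < Nu D
     then mat (dim_col B) (dim_col B * Nu D) (\<lambda>(i, j). if j = k * dim_col B + i then 1 else 0)
     else gainK D * Psi k)"

definition qpH :: "real mat" where
  "qpH = (Psi (Nx D))\<^sup>T * wtP D * Psi (Nx D) +
     mat_sum (dim_col B * Nu D) (dim_col B * Nu D)
       (\<lambda>k. (Psi k)\<^sup>T * wtQ D * Psi k + (Lam k)\<^sup>T * wtR D * Lam k) {..<Nx D}"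

definition qpF :: "real mat" where
  "qpF = (Phi (Nx D))\<^sup>T * wtP D * Psi (Nx D) +
     mat_sum (dim_row A) (dim_col B * Nu D)
       (\<lambda>k. (Phi k)\<^sup>T * wtQ D * Psi k + (Theta k)\<^sup>T * wtR D * Lam k) {..<Nx D}"

definition qpG :: "real mat" where
  "qpG = vstack (dim_col B * Nu D) (map (\<lambda>k. conX D * Psi k + conU D * Lam k) [0..<Nc D])"

definition qpW :: "real vec" where
  "qpW = vstack_vec (map (\<lambda>k. conD D) [0..<Nc D])"

definition qpE :: "real mat" where
  "qpE = vstack (dim_row A) (map (\<lambda>k. - (conX D * Phi k + conU D * Theta k)) [0..<Nc D])"

definition qpHinv :: "real mat" where
  "qpHinv = the (mat_inverse qpH)"

definition qpS :: "real mat" where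
  "qpS = qpE + qpG * qpHinv * qpF\<^sup>T"

definition qp_feasible :: "real vec \<Rightarrow> real vec \<Rightarrow> bool" where
  "qp_feasible x z \<longleftrightarrow> z \<in> carrier_vec (dim_col B * Nu D) \<and> qpG *\<^sub>v z \<le> qpW + qpS *\<^sub>v x"

definition qp_minimizer :: "real vec \<Rightarrow> real vec \<Rightarrow> bool" where
  "qp_minimizer x z \<longleftrightarrow> is_arg_min (\<lambda>z. z \<bullet> (qpH *\<^sub>v z)) (qp_feasible x) z"

(* The minimizer exists and is unique for every feasible x whenever qpH is positive definite,
   which holds if wtQ, wtP are positive semidefinite and wtR positive definite with 1 \<le> Nu \<le> Nx. *)
definition qp_opt :: "real vec \<Rightarrow> real vec" where
  "qp_opt x = (THE z. qp_minimizer x z)"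

definition qp_active :: "real vec \<Rightarrow> nat set" where
  "qp_active x = {i. i < dim_row qpG \<and> (qpG *\<^sub>v qp_opt x) $ i = (qpW + qpS *\<^sub>v x) $ i}"

definition opt_inputs :: "real vec \<Rightarrow> real vec" where
  "opt_inputs x = qp_opt x - (qpHinv * qpF\<^sup>T) *\<^sub>v x"

(* A partial function: its domain consists of the states with a feasible program. *)
definition explicit_law :: "real vec \<Rightarrow> real vec option" where
  "explicit_law x =
     (if x \<in> carrier_vec (dim_row A) \<and> (\<exists>z. qp_feasible x z)
      then Some (vec_first (opt_inputs x) (dim_col B)) else None)"

lemma pred_matrices_carrier:
  assumes A: "A \<in> carrier_mat n n" and B: "B \<in> carrier_mat n m"
    and K: "gainK D \<in> carrier_mat m n"
  shows "Phi k \<in> carrier_mat n n" "Theta k \<in> carrier_mat m n"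
    "Psi k \<in> carrier_mat n (m * Nu D)" "Lam k \<in> carrier_mat m (m * Nu D)"
proof -
  have dims: "dim_row A = n" "dim_col B = m" using A B by auto
  have "Phi k \<in> carrier_mat n n \<and> Psi k \<in> carrier_mat n (m * Nu D)"
    by (induction k) (use A B K dims in \<open>auto intro!: add_carrier_mat mult_carrier_mat\<close>)
  then show "Phi k \<in> carrier_mat n n" "Theta k \<in> carrier_mat m n"
    "Psi k \<in> carrier_mat n (m * Nu D)" "Lam k \<in> carrier_mat m (m * Nu D)"
    using K dims by (auto intro!: mult_carrier_mat)
qed

lemma selection_mult_vec:
  assumes U: "U \<in> carrier_vec (m * N)" and k: "k < N"
  shows "mat m (m * N) (\<lambda>(i, j). if j = k * m + i then 1 else 0) *\<^sub>v U = input_block m U k"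
proof (rule eq_vecI)
  fix i assume "i < dim_vec (input_block m U k)"
  then have i: "i < m" by (simp add: input_block_def)
  have "k * m + i < Suc k * m" using i by simp
  also have "\<dots> \<le> N * m" using k by (intro mult_le_mono1) simp
  finally have lt: "k * m + i < m * N" by (simp add: mult.commute)
  have "(\<Sum>j = 0..<m * N. (if j = k * m + i then 1 else 0) * U $ j)
      = (\<Sum>j = 0..<m * N. if j = k * m + i then U $ j else 0)"
    by (intro sum.cong) auto
  also have "\<dots> = U $ (k * m + i)" using lt by (subst sum.delta) auto
  finally show "(mat m (m * N) (\<lambda>(i, j). if j = k * m + i then 1 else 0) *\<^sub>v U) $ i
      = input_block m U k $ i"
    using i U by (simp add: input_block_def scalar_prod_def)
qed (simp add: input_block_def)

lemma prediction:
  assumes A: "A \<in> carrier_mat n n" and B: "B \<in> carrier_mat n m"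
    and K: "gainK D \<in> carrier_mat m n"
    and x: "x \<in> carrier_vec n" and U: "U \<in> carrier_vec (m * Nu D)"
  shows "pred_state x U k = Phi k *\<^sub>v x + Psi k *\<^sub>v U"
    and "pred_input x U k = Theta k *\<^sub>v x + Lam k *\<^sub>v U"
proof -
  have dims: "dim_row A = n" "dim_col B = m" using A B by auto
  note c = pred_matrices_carrier[OF A B K]
  have inp: "pred_input x U k = Theta k *\<^sub>v x + Lam k *\<^sub>v U"
    if s: "pred_state x U k = Phi k *\<^sub>v x + Psi k *\<^sub>v U" for k
  proof (cases "k < Nu D")
    case True
    then show ?thesis
      using selection_mult_vec[OF U True] x dims by (auto simp: input_block_def)
  next
    case False
    have "gainK D *\<^sub>v (Phi k *\<^sub>v x + Psi k *\<^sub>v U)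
        = gainK D *\<^sub>v (Phi k *\<^sub>v x) + gainK D *\<^sub>v (Psi k *\<^sub>v U)"
      by (rule mult_add_distrib_mat_vec[OF K])
        (rule mult_mat_vec_carrier[OF c(1) x] mult_mat_vec_carrier[OF c(3) U])+
    also have "\<dots> = (gainK D * Phi k) *\<^sub>v x + (gainK D * Psi k) *\<^sub>v U"
      by (simp add: assoc_mult_mat_vec[OF K c(1) x] assoc_mult_mat_vec[OF K c(3) U])
    finally show ?thesis using False s by simp
  qed
  show st: "pred_state x U k = Phi k *\<^sub>v x + Psi k *\<^sub>v U"
  proof (induction k)
    case 0
    then show ?case using x U dims by auto
  next
    case (Suc k)
    define a b c' d' where "a = A *\<^sub>v (Phi k *\<^sub>v x)" and "b = A *\<^sub>v (Psi k *\<^sub>v U)"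
      and "c' = B *\<^sub>v (Theta k *\<^sub>v x)" and "d' = B *\<^sub>v (Lam k *\<^sub>v U)"
    have cc: "a \<in> carrier_vec n" "b \<in> carrier_vec n" "c' \<in> carrier_vec n" "d' \<in> carrier_vec n"
      unfolding a_def b_def c'_def d'_def
      by (rule mult_mat_vec_carrier[OF A] mult_mat_vec_carrier[OF B]
            mult_mat_vec_carrier[OF c(1) x] mult_mat_vec_carrier[OF c(2) x]
            mult_mat_vec_carrier[OF c(3) U] mult_mat_vec_carrier[OF c(4) U])+
    have "pred_state x U (Suc k) = A *\<^sub>v (Phi k *\<^sub>v x + Psi k *\<^sub>v U)
        + B *\<^sub>v (Theta k *\<^sub>v x + Lam k *\<^sub>v U)"
      using inp[OF Suc] Suc by (simp del: pred_input.simps Theta.simps Lam.simps)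
    also have "A *\<^sub>v (Phi k *\<^sub>v x + Psi k *\<^sub>v U) = a + b"
      unfolding a_def b_def
      by (rule mult_add_distrib_mat_vec[OF A])
        (rule mult_mat_vec_carrier[OF c(1) x] mult_mat_vec_carrier[OF c(3) U])+
    also have "B *\<^sub>v (Theta k *\<^sub>v x + Lam k *\<^sub>v U) = c' + d'"
      unfolding c'_def d'_def
      by (rule mult_add_distrib_mat_vec[OF B])
        (rule mult_mat_vec_carrier[OF c(2) x] mult_mat_vec_carrier[OF c(4) U])+
    also have "a + b + (c' + d') = (a + c') + (b + d')"
      using cc by (intro eq_vecI) auto
    also have "a + c' = Phi (Suc k) *\<^sub>v x"
      unfolding a_def c'_def Phi.simps
      using add_mult_distrib_mat_vec[OF mult_carrier_mat[OF A c(1)] mult_carrier_mat[OF B c(2)] x]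
        assoc_mult_mat_vec[OF A c(1) x] assoc_mult_mat_vec[OF B c(2) x]
      by (simp del: Theta.simps)
    also have "b + d' = Psi (Suc k) *\<^sub>v U"
      unfolding b_def d'_def Psi.simps
      using add_mult_distrib_mat_vec[OF mult_carrier_mat[OF A c(3)] mult_carrier_mat[OF B c(4)] U]
        assoc_mult_mat_vec[OF A c(3) U] assoc_mult_mat_vec[OF B c(4) U]
      by (simp del: Lam.simps)
    finally show ?case .
  qed
  show "pred_input x U k = Theta k *\<^sub>v x + Lam k *\<^sub>v U"
    by (rule inp[OF st])
qed

end

end

theory Submission
  imports Defs
begin

text \<open>
  A noiseless trajectory satisfies \<open>X1 = [B A] [U0; X0]\<close>, so every right inverse of the data
  matrix recovers \<open>[B A]\<close> exactly. The two explicit laws are then built from the same matrices.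
\<close>

text \<open>\<open>append_rows\<close> is by definition a four-block matrix whose right blocks have
  width zero; transposing turns them into lower blocks of height zero. This form gives access to the
  block rules for entries and products.\<close>

lemma hcat_four_block:
  assumes "M \<in> carrier_mat r c1" and "N \<in> carrier_mat r c2"
  shows "hcat M N = four_block_mat M N (0\<^sub>m 0 c1) (0\<^sub>m 0 c2)"
  using assms unfolding hcat_def append_rows_def
  by (subst transpose_four_block_mat[of _ c1 r _ 0 _ c2]) auto

text \<open>Both sides are cut at the same column \<open>c1\<close>, so comparing entries separates
  the blocks. This is what later splits one matrix identity into one for each system matrix.\<close>

lemma hcat_eq_iff:
  assumes "M \<in> carrier_mat r c1" and "N \<in> carrier_mat r c2"
    and "M' \<in> carrier_mat r c1" and "N' \<in> carrier_mat r c2"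
  shows "hcat M N = hcat M' N' \<longleftrightarrow> M = M' \<and> N = N'"
proof
  assume eq: "hcat M N = hcat M' N'"
  have entry: "(if j < c1 then M $$ (i, j) else N $$ (i, j - c1))
      = (if j < c1 then M' $$ (i, j) else N' $$ (i, j - c1))"
    if "i < r" "j < c1 + c2" for i j
    using arg_cong[OF eq, of "\<lambda>L. L $$ (i, j)"] that assms
    by (auto simp: hcat_four_block[OF assms(1,2)] hcat_four_block[OF assms(3,4)])
  have "M $$ (i, j) = M' $$ (i, j)" if "i < r" "j < c1" for i j
    using entry[of i j] that by simp
  moreover have "N $$ (i, j) = N' $$ (i, j)" if "i < r" "j < c2" for i j
    using entry[of i "c1 + j"] that by simp
  ultimately show "M = M' \<and> N = N'"
    using assms by auto
qed simp

lemma hcat_mult_append_rows: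
  assumes M: "M \<in> carrier_mat r c1" and N: "N \<in> carrier_mat r c2"
    and V: "V \<in> carrier_mat c1 t" and W: "W \<in> carrier_mat c2 t"
  shows "hcat M N * (V @\<^sub>r W) = M * V + N * W"
proof -
  \<comment> \<open>Each of the last three blocks has no rows or no columns, so only the upper left
    one contributes entries.\<close>
  have "hcat M N * (V @\<^sub>r W) = four_block_mat (M * V + N * W)
      (M * 0\<^sub>m c1 0 + N * 0\<^sub>m c2 0) (0\<^sub>m 0 c1 * V + 0\<^sub>m 0 c2 * W)
      (0\<^sub>m 0 c1 * 0\<^sub>m c1 0 + 0\<^sub>m 0 c2 * 0\<^sub>m c2 0)"
    using assms unfolding hcat_four_block[OF M N] append_rows_def
    by (subst mult_four_block_mat[of _ r c1 _ c2 _ 0 _ _ t _ 0]) auto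
  also have "\<dots> = M * V + N * W"
    using assms by (intro eq_matI) auto
  finally show ?thesis .
qed

text \<open>Column \<open>t\<close> of the identity is the system equation at time \<open>t\<close>:
  the list on the left starts at time 1, so its entry \<open>t\<close> is
  \<open>x (t + 1)\<close>.\<close>

lemma trajectory_data_equation:
  assumes A: "A \<in> carrier_mat n n" and B: "B \<in> carrier_mat n m"
    and x: "\<And>t. t \<le> T \<Longrightarrow> x t \<in> carrier_vec n" and u: "\<And>t. t < T \<Longrightarrow> u t \<in> carrier_vec m"
    and step: "\<And>t. t < T \<Longrightarrow> x (t + 1) = A *\<^sub>v x t + B *\<^sub>v u t"
  shows "mat_of_cols n (map x [1..<T + 1]) =
    B * mat_of_cols m (map u [0..<T]) + A * mat_of_cols n (map x [0..<T])"
    (is "?X1 = B * ?U + A * ?X")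
proof (rule eq_matI)
  fix i t assume "i < dim_row (B * ?U + A * ?X)" and "t < dim_col (B * ?U + A * ?X)"
  then have i: "i < n" and t: "t < T" using A by auto
  have "col ?U t = u t" "col ?X t = x t"
    using t u x by (auto intro!: col_mat_of_cols[THEN trans])
  \<comment> \<open>\<open>upt_Suc\<close> is disabled so that \<open>[1..<T + 1]\<close> is indexed
    as a whole instead of being split at its last element.\<close>
  then show "?X1 $$ (i, t) = (B * ?U + A * ?X) $$ (i, t)"
    using A B i t step[OF t] by (simp add: mat_of_cols_index add.commute del: upt_Suc)
qed (use A in auto)

text \<open>The data equation factors as \<open>hcat B A\<close> times the stacked data, and any
  right inverse \<open>R\<close> cancels the second factor. Inputs lie above states, hence
  \<open>B\<close> stands before \<open>A\<close>.\<close>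

lemma data_identifies_system:
  assumes A: "A \<in> carrier_mat n n" and B: "B \<in> carrier_mat n m"
    and g: "g \<in> carrier_mat n m" and \<xi>: "\<xi> \<in> carrier_mat n n"
    and U: "U \<in> carrier_mat m T" and X: "X \<in> carrier_mat n T"
    and R: "is_right_inverse (U @\<^sub>r X) R"
    and eq: "hcat g \<xi> = (B * U + A * X) * R"
  shows "g = B" and "\<xi> = A"
proof -
  have UX: "U @\<^sub>r X \<in> carrier_mat (m + n) T"
    using U X by (rule carrier_append_rows)
  have Rc: "R \<in> carrier_mat T (m + n)" and inv: "(U @\<^sub>r X) * R = 1\<^sub>m (m + n)"
    using R UX by (auto simp: is_right_inverse_def)
  have BA: "hcat B A \<in> carrier_mat n (m + n)"
    using A B unfolding hcat_four_block[OF B A] by (intro carrier_matI) auto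
  have "hcat g \<xi> = hcat B A * (U @\<^sub>r X) * R"
    by (simp add: eq hcat_mult_append_rows[OF B A U X])
  also have "\<dots> = hcat B A"
    by (simp add: assoc_mult_mat[OF BA UX Rc] inv right_mult_one_mat[OF BA])
  finally show "g = B" and "\<xi> = A"
    using hcat_eq_iff[OF g \<xi> B A] by auto
qed

text \<open>The identified pair enters through its sizes and its block equation, which determine it
  by \<open>hcat_eq_iff\<close>; \<open>Ddag\<close> stands for an arbitrary right inverse.\<close>

theorem theorem3:
  fixes n m p T :: nat
    and A B U0 X0 X1 Ddag gamma\<^sub>d xi\<^sub>d :: "real mat"
    and x u :: "nat \<Rightarrow> real vec"
    and D :: mpc_design
  assumes "A \<in> carrier_mat n n" and "B \<in> carrier_mat n m"
    and "1 \<le> Nx D" and "1 \<le> Nu D" and "1 \<le> Nc D" and "Nu D \<le> Nx D"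
    and "pos_semidef n (wtQ D)" and "pos_semidef n (wtP D)" and "pos_def m (wtR D)"
    and "gainK D \<in> carrier_mat m n"
    and "conX D \<in> carrier_mat p n" and "conU D \<in> carrier_mat p m"
    and "conD D \<in> carrier_vec p"
    and "\<And>t. t \<le> T \<Longrightarrow> x t \<in> carrier_vec n" and "\<And>t. t < T \<Longrightarrow> u t \<in> carrier_vec m"
    and "\<And>t. t < T \<Longrightarrow> x (t + 1) = A *\<^sub>v x t + B *\<^sub>v u t"
    and "U0 = mat_of_cols m (map u [0..<T])"
    and "X0 = mat_of_cols n (map x [0..<T])"
    and "X1 = mat_of_cols n (map x [1..<T + 1])"
    and "vec_space.rank (m + n) (U0 @\<^sub>r X0) = n + m"
    and "is_right_inverse (U0 @\<^sub>r X0) Ddag"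
    and "gamma\<^sub>d \<in> carrier_mat n m" and "xi\<^sub>d \<in> carrier_mat n n"
    and "hcat gamma\<^sub>d xi\<^sub>d = X1 * Ddag"
    and "\<And>y. y \<in> carrier_vec n \<Longrightarrow> \<exists>z. qp_feasible D xi\<^sub>d gamma\<^sub>d y z \<Longrightarrow>
           rows_lin_indep (qpG D xi\<^sub>d gamma\<^sub>d) (qp_active D xi\<^sub>d gamma\<^sub>d y)"
  shows "dom (explicit_law D xi\<^sub>d gamma\<^sub>d) = dom (explicit_law D A B) \<and>
    (\<forall>y \<in> dom (explicit_law D A B).
       explicit_law D xi\<^sub>d gamma\<^sub>d y = explicit_law D A B y)"
proof -
  have U0: "U0 \<in> carrier_mat m T" and X0: "X0 \<in> carrier_mat n T"
    using assms(17,18) by auto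
  have "X1 = B * U0 + A * X0"
    unfolding assms(17-19) by (rule trajectory_data_equation[where x = x and u = u, OF assms(1,2,14-16)])
  then have "gamma\<^sub>d = B" and "xi\<^sub>d = A"
    using data_identifies_system[OF assms(1,2,22,23) U0 X0 assms(21)] assms(24) by simp_all
  \<comment> \<open>After rewriting, both laws are the same term \<open>explicit_law D A B\<close>,
    so domains and values agree trivially.\<close>
  then show ?thesis by simp
qed

end
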